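(* Let $H=(S,\circ)$ and $K=(T,\circ)$ be groups endowed with cancellative affine structures $\sigma^S$ and $\sigma^T$, respectively, and let $(S,T,\alpha,\beta)$ be a matched product system of groups. Write $\sigma_a:=\sigma^S_a$ for $a\in S$ and $\sigma_u:=\sigma^T_u$ for $u\in T$. Then the map $\sigma:S\times T\to (S\times T)^{S\times T}$ defined by $\sigma_{(a,u)}(b,v)=(\sigma_a(b),\sigma_u(v))$, for all $(a,u),(b,v)\in S\times T$, is a cancellative affine structure on the group $H\bowtie_{\alpha,\beta}K$ if and only if the following identities hold for all $a,b\in S$ and $u,v\in T$: (II) $\sigma_{\alpha_u(a)}=\sigma_a$ and $\sigma_{\beta_a(u)}=\sigma_u$; (III) $\alpha_{\bar v}\,\sigma_{\rho_b(a^-)}=\sigma_{\rho_b(a^-)}\,\alpha_{\overline V}$ and $\beta_{\bar b}\,\sigma_{\rho_v(u^-)}=\sigma_{\rho_v(u^-)}\,\beta_{\overline B}$, where $\bar v=\beta_b^{-1}(v)$, $\bar b=\alpha_v^{-1}(b)$, $\overline V=\beta^{-1}_{\sigma_a(b)}\sigma_u(v)$, $\overline B=\alpha^{-1}_{\sigma_u(v)}\sigma_a(b)$, $\rho_b(a^-)=\sigma_a(b)^-\circ a^-\circ b$ and $\rho_v(u^-)=\sigma_u(v)^-\circ u^-\circ v$.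
   Context: For a group $(B,\circ)$, $0$ denotes its identity and $a^-$ the inverse of $a$. $B^B$ is the monoid (under composition) of all maps $B\to B$ and $\mathrm{Sym}_B$ is the symmetric group on $B$. For a map $\sigma:B\to B^B$ write $\sigma_a:=\sigma(a)$, and similarly for $\alpha,\beta$; juxtaposition of maps is composition. An affine structure on a group $(B,\circ)$ is a map $\sigma:B\to B^B$ that is a semigroup anti-homomorphism, i.e. $\sigma_{a\circ b}=\sigma_b\sigma_a$ for all $a,b\in B$ (it is not required that $\sigma_0=\mathrm{id}_B$), such that $\sigma_a(b\circ\sigma_b(c))=\sigma_a(b)\circ\sigma_{\sigma_a(b)}\sigma_a(c)$ for all $a,b,c\in B$. It is cancellative if $\sigma(B)\subseteq\mathrm{Sym}_B$. A matched product system of groups $(S,T,\alpha,\beta)$ consists of groups $H=(S,\circ)$, $K=(T,\circ)$ and group homomorphisms $\alpha:K\to\mathrm{Sym}_S$, $\beta:H\to\mathrm{Sym}_T$ such that, for all $a,b\in S$, $u,v\in T$, $$\alpha_u(\alpha_u^{-1}(a)\circ b)=a\circ\alpha_{\beta_a^{-1}(u)}(b),\qquad \beta_a(\beta_a^{-1}(u)\circ v)=u\circ\beta_{\alpha_u^{-1}(a)}(v).$$ Then $H\bowtie_{\alpha,\beta}K$ denotes the group on $S\times T$ with operation $$(a,u)\circ(b,v)=\bigl(a\circ\alpha_{\beta_a^{-1}(u)}(b),\;u\circ\beta_{\alpha_u^{-1}(a)}(v)\bigr),$$ whose identity is $(0,0)$. For an affine structure $\sigma$ on $(B,\circ)$,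 $\rho_b(a):=\sigma_{a^-}(b)^-\circ a\circ b$ for $a,b\in B$. *)

theory Defs
  imports "HOL-Algebra.Algebra"
begin

text \<open>
  For a set \<open>A\<close>, the monoid of all maps \<open>A \<rightarrow> A\<close> is represented by the extensional functions
  \<open>A \<rightarrow>\<^sub>E A\<close> with composition \<^term>\<open>compose A\<close>, and the symmetric group by \<^term>\<open>BijGroup A\<close>,
  whose carrier \<^term>\<open>Bij A\<close> consists of the extensional bijections of \<open>A\<close>. Hence
  equality of maps on \<open>A\<close> is HOL equality.
\<close>

locale affine_structure = group G for G (structure) +
  fixes \<sigma> :: "'a \<Rightarrow> 'a \<Rightarrow> 'a"
  assumes maps: "\<sigma> \<in> carrier G \<rightarrow> (carrier G \<rightarrow>\<^sub>E carrier G)"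
    and anti_hom: "\<lbrakk>a \<in> carrier G; b \<in> carrier G\<rbrakk> \<Longrightarrow> \<sigma> (a \<otimes> b) = compose (carrier G) (\<sigma> b) (\<sigma> a)"
    and affine: "\<lbrakk>a \<in> carrier G; b \<in> carrier G; c \<in> carrier G\<rbrakk>
      \<Longrightarrow> \<sigma> a (b \<otimes> \<sigma> b c) = \<sigma> a b \<otimes> \<sigma> (\<sigma> a b) (\<sigma> a c)"

locale cancellative_affine_structure = affine_structure +
  assumes cancellative: "\<sigma> ` carrier G \<subseteq> Bij (carrier G)"

text \<open>\<open>affine_rho G \<sigma> b a\<close> is \<open>\<rho>\<^sub>b(a)\<close>.\<close>

definition affine_rho :: "('a, 'm) monoid_scheme \<Rightarrow> ('a \<Rightarrow> 'a \<Rightarrow> 'a) \<Rightarrow> 'a \<Rightarrow> 'a \<Rightarrow> 'a" where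
  "affine_rho G \<sigma> b a = inv\<^bsub>G\<^esub> (\<sigma> (inv\<^bsub>G\<^esub> a) b) \<otimes>\<^bsub>G\<^esub> a \<otimes>\<^bsub>G\<^esub> b"

text \<open>
  Throughout, the inverse permutations \<open>\<alpha>\<^sub>u\<^sup>-\<^sup>1\<close> and \<open>\<beta>\<^sub>a\<^sup>-\<^sup>1\<close> are
  \<^term>\<open>inv_into (carrier H) (\<alpha> u)\<close> and \<^term>\<open>inv_into (carrier K) (\<beta> a)\<close>.
\<close>

locale matched_product_system = H: group H + K: group K
  for H :: "('a, 'm) monoid_scheme" and K :: "('b, 'n) monoid_scheme" +
  fixes \<alpha> :: "'b \<Rightarrow> 'a \<Rightarrow> 'a" and \<beta> :: "'a \<Rightarrow> 'b \<Rightarrow> 'b"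
  assumes alpha_hom: "\<alpha> \<in> hom K (BijGroup (carrier H))"
    and beta_hom: "\<beta> \<in> hom H (BijGroup (carrier K))"
    and alpha_matched: "\<lbrakk>a \<in> carrier H; b \<in> carrier H; u \<in> carrier K\<rbrakk>
      \<Longrightarrow> \<alpha> u (inv_into (carrier H) (\<alpha> u) a \<otimes>\<^bsub>H\<^esub> b)
        = a \<otimes>\<^bsub>H\<^esub> \<alpha> (inv_into (carrier K) (\<beta> a) u) b"
    and beta_matched: "\<lbrakk>a \<in> carrier H; u \<in> carrier K; v \<in> carrier K\<rbrakk>
      \<Longrightarrow> \<beta> a (inv_into (carrier K) (\<beta> a) u \<otimes>\<^bsub>K\<^esub> v)
        = u \<otimes>\<^bsub>K\<^esub> \<beta> (inv_into (carrier H) (\<alpha> u) a) v"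

definition matched_product ::
  "('a, 'm) monoid_scheme \<Rightarrow> ('b, 'n) monoid_scheme \<Rightarrow> ('b \<Rightarrow> 'a \<Rightarrow> 'a) \<Rightarrow> ('a \<Rightarrow> 'b \<Rightarrow> 'b)
    \<Rightarrow> ('a \<times> 'b) monoid" where
  "matched_product H K \<alpha> \<beta> =
    \<lparr>carrier = carrier H \<times> carrier K,
     monoid.mult = (\<lambda>(a, u) (b, v).
       (a \<otimes>\<^bsub>H\<^esub> \<alpha> (inv_into (carrier K) (\<beta> a) u) b,
        u \<otimes>\<^bsub>K\<^esub> \<beta> (inv_into (carrier H) (\<alpha> u) a) v)),
     monoid.one = (\<one>\<^bsub>H\<^esub>, \<one>\<^bsub>K\<^esub>)\<rparr>"

definition product_affine ::
  "'a set \<Rightarrow> 'b set \<Rightarrow> ('a \<Rightarrow> 'a \<Rightarrow> 'a) \<Rightarrow> ('b \<Rightarrow> 'b \<Rightarrow> 'b) \<Rightarrow> 'a \<times> 'b \<Rightarrow> 'a \<times> 'b \<Rightarrow> 'a \<times> 'b" where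
  "product_affine S T \<sigma>S \<sigma>T = (\<lambda>(a, u). \<lambda>(b, v)\<in>S \<times> T. (\<sigma>S a b, \<sigma>T u v))"

end

theory Submission
  imports Defs
begin

text \<open>
  Since every \<open>\<sigma>\<^sub>a\<close> is bijective, the defining identities decouple. The anti-homomorphism
  property reads \<open>\<sigma>\<^bsub>\<alpha>\<^sub>u(b)\<^esub> \<sigma>\<^sub>a = \<sigma>\<^sub>b \<sigma>\<^sub>a\<close> in the first coordinate, and cancelling \<open>\<sigma>\<^sub>a\<close> gives (II).
  In the affine identity one writes \<open>\<alpha>\<^bsub>v'\<^esub> \<sigma>\<^sub>b(c) = \<sigma>\<^sub>b(c')\<close> and applies the affine identity of the
  factor; with \<open>P = \<sigma>\<^bsub>\<sigma>\<^sub>a(b)\<^esub> \<sigma>\<^sub>a \<sigma>\<^sub>b\<^sup>-\<^sup>1\<close> what remains is \<open>P \<alpha>\<^bsub>v'\<^esub> = \<alpha>\<^sub>V P\<close>. This is (III),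
  because the anti-homomorphism property identifies \<open>P\<^sup>-\<^sup>1\<close> with \<open>\<sigma>\<^bsub>\<rho>\<^sub>b(a\<^sup>-)\<^esub>\<close>.
\<close>

section \<open>The group structure of a matched product\<close>

lemma hom_BijGroup_mult:
  assumes "f \<in> hom G (BijGroup A)" "u \<in> carrier G" "v \<in> carrier G" "x \<in> A"
  shows "f (u \<otimes>\<^bsub>G\<^esub> v) x = f u (f v x)"
proof -
  have "f u \<in> Bij A" "f v \<in> Bij A"
    using assms(1-3) by (auto simp: hom_def BijGroup_def)
  then show ?thesis
    using hom_mult[OF assms(1-3)] assms(4) by (simp add: BijGroup_def compose_def)
qed

context matched_product_system
begin

text \<open>The axioms are symmetric in the two factors, so each fact about \<alpha> yields its
  mirror image for \<beta> by instantiation.\<close>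

lemma swap: "matched_product_system K H \<beta> \<alpha>"
  by unfold_locales (use alpha_hom beta_hom alpha_matched beta_matched in auto)

lemma alpha_bij: "u \<in> carrier K \<Longrightarrow> bij_betw (\<alpha> u) (carrier H) (carrier H)"
  using alpha_hom by (auto simp: hom_def BijGroup_def Bij_def)

lemma alpha_closed [simp]:
  "\<lbrakk>u \<in> carrier K; a \<in> carrier H\<rbrakk> \<Longrightarrow> \<alpha> u a \<in> carrier H"
  using alpha_bij bij_betwE by blast

lemma alpha_inv_closed [simp]:
  "\<lbrakk>u \<in> carrier K; a \<in> carrier H\<rbrakk> \<Longrightarrow> inv_into (carrier H) (\<alpha> u) a \<in> carrier H"
  by (metis alpha_bij bij_betw_imp_surj_on inv_into_into)

lemma alpha_inv_right [simp]:
  "\<lbrakk>u \<in> carrier K; a \<in> carrier H\<rbrakk> \<Longrightarrow> \<alpha> u (inv_into (carrier H) (\<alpha> u) a) = a"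
  by (metis alpha_bij bij_betw_inv_into_right)

lemma alpha_inv_left [simp]:
  "\<lbrakk>u \<in> carrier K; a \<in> carrier H\<rbrakk> \<Longrightarrow> inv_into (carrier H) (\<alpha> u) (\<alpha> u a) = a"
  by (metis alpha_bij bij_betw_inv_into_left)

lemma alpha_mult:
  "\<lbrakk>u \<in> carrier K; v \<in> carrier K; a \<in> carrier H\<rbrakk> \<Longrightarrow> \<alpha> (u \<otimes>\<^bsub>K\<^esub> v) a = \<alpha> u (\<alpha> v a)"
  by (rule hom_BijGroup_mult[OF alpha_hom])

text \<open>The value of a homomorphism at the identity is idempotent; being also injective, it
  fixes every point.\<close>

lemma alpha_one [simp]:
  assumes "a \<in> carrier H" shows "\<alpha> \<one>\<^bsub>K\<^esub> a = a"
proof -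
  have "\<alpha> \<one>\<^bsub>K\<^esub> (\<alpha> \<one>\<^bsub>K\<^esub> a) = \<alpha> \<one>\<^bsub>K\<^esub> a"
    using alpha_mult[of "\<one>\<^bsub>K\<^esub>" "\<one>\<^bsub>K\<^esub>" a] assms by simp
  then show ?thesis
    by (metis K.one_closed alpha_inv_left alpha_closed assms)
qed

text \<open>The matching axiom solved for the action on a product: \<alpha> fails to be
  multiplicative only by a twist of its index on the second factor.\<close>

lemma alpha_mult_right:
  assumes "u \<in> carrier K" "a \<in> carrier H" "b \<in> carrier H"
  shows "\<alpha> u (a \<otimes>\<^bsub>H\<^esub> b) = \<alpha> u a \<otimes>\<^bsub>H\<^esub> \<alpha> (inv_into (carrier K) (\<beta> (\<alpha> u a)) u) b"
  using alpha_matched[of "\<alpha> u a" b u] assms by simp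

lemmas beta_closed [simp] = matched_product_system.alpha_closed[OF swap]
lemmas beta_inv_closed [simp] = matched_product_system.alpha_inv_closed[OF swap]
lemmas beta_inv_right [simp] = matched_product_system.alpha_inv_right[OF swap]
lemmas beta_inv_left [simp] = matched_product_system.alpha_inv_left[OF swap]
lemmas beta_mult = matched_product_system.alpha_mult[OF swap]
lemmas beta_one [simp] = matched_product_system.alpha_one[OF swap]

lemma alpha_inv_one [simp]:
  "a \<in> carrier H \<Longrightarrow> inv_into (carrier H) (\<alpha> \<one>\<^bsub>K\<^esub>) a = a"
  using alpha_inv_left[of "\<one>\<^bsub>K\<^esub>" a] by simp

lemma alpha_fixes_one [simp]:
  assumes "u \<in> carrier K" shows "\<alpha> u \<one>\<^bsub>H\<^esub> = \<one>\<^bsub>H\<^esub>"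
proof -
  have inv: "inv_into (carrier K) (\<beta> \<one>\<^bsub>H\<^esub>) u = u"
    using beta_inv_left[of "\<one>\<^bsub>H\<^esub>" u] assms by simp
  have "\<one>\<^bsub>H\<^esub> \<otimes>\<^bsub>H\<^esub> \<alpha> u \<one>\<^bsub>H\<^esub> = \<alpha> u (inv_into (carrier H) (\<alpha> u) \<one>\<^bsub>H\<^esub> \<otimes>\<^bsub>H\<^esub> \<one>\<^bsub>H\<^esub>)"
    using alpha_matched[of "\<one>\<^bsub>H\<^esub>" "\<one>\<^bsub>H\<^esub>" u] assms inv by simp
  then show ?thesis using assms by simp
qed

text \<open>This computes the twisted index of a product \<open>(a, u) (b, v)\<close>, as needed for
  associativity. Put \<open>x = \<alpha> u' b\<close>. Matching at \<open>x\<close> sends the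
  right-hand side under \<open>\<beta> x\<close> to \<open>u' v\<close>, because
  \<open>\<alpha> u'\<close> maps \<open>b\<close> to \<open>x\<close>. Matching at \<open>a\<close>
  then sends \<open>u' v\<close> under \<open>\<beta> a\<close> to the second coordinate of the
  product.\<close>

lemma beta_inv_mult:
  assumes "a \<in> carrier H" "b \<in> carrier H" "u \<in> carrier K" "v \<in> carrier K"
  defines "u' \<equiv> inv_into (carrier K) (\<beta> a) u"
  shows "inv_into (carrier K) (\<beta> (a \<otimes>\<^bsub>H\<^esub> \<alpha> u' b))
           (u \<otimes>\<^bsub>K\<^esub> \<beta> (inv_into (carrier H) (\<alpha> u) a) v)
         = inv_into (carrier K) (\<beta> (\<alpha> u' b)) u' \<otimes>\<^bsub>K\<^esub> inv_into (carrier K) (\<beta> b) v"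
    (is "inv_into _ (\<beta> ?A) ?U = ?w")
proof -
  let ?x = "\<alpha> u' b" and ?v' = "inv_into (carrier K) (\<beta> b) v"
  have u': "u' \<in> carrier K" "\<beta> a u' = u" using assms by auto
  have "\<beta> ?x ?w = u' \<otimes>\<^bsub>K\<^esub> v"
    using beta_matched[of ?x u' ?v'] assms u' by simp
  moreover have "\<beta> a (u' \<otimes>\<^bsub>K\<^esub> v) = ?U"
    using beta_matched[of a u v] assms by simp
  ultimately have "\<beta> ?A ?w = ?U"
    using beta_mult[of a ?x ?w] assms u' by simp
  then show ?thesis
    using beta_inv_left[of ?A ?w] assms u' by simp
qed

text \<open>On the right, \<open>alpha_mult_right\<close> splits off \<open>\<alpha> u' b\<close>
  and leaves two successive permutations acting on \<open>c\<close>. By \<open>beta_inv_mult\<close>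
  their composite is the single permutation on the left.\<close>

lemma matched_product_assoc_fst:
  assumes "a \<in> carrier H" "b \<in> carrier H" "c \<in> carrier H" "u \<in> carrier K" "v \<in> carrier K"
  defines "u' \<equiv> inv_into (carrier K) (\<beta> a) u" and "v' \<equiv> inv_into (carrier K) (\<beta> b) v"
  shows "(a \<otimes>\<^bsub>H\<^esub> \<alpha> u' b) \<otimes>\<^bsub>H\<^esub>
      \<alpha> (inv_into (carrier K) (\<beta> (a \<otimes>\<^bsub>H\<^esub> \<alpha> u' b))
          (u \<otimes>\<^bsub>K\<^esub> \<beta> (inv_into (carrier H) (\<alpha> u) a) v)) c
    = a \<otimes>\<^bsub>H\<^esub> \<alpha> u' (b \<otimes>\<^bsub>H\<^esub> \<alpha> v' c)"
proof -
  have "u' \<in> carrier K" "v' \<in> carrier K" using assms by auto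
  then show ?thesis
    using assms(1-5) unfolding u'_def v'_def
    by (simp add: beta_inv_mult alpha_mult alpha_mult_right H.m_assoc)
qed

lemmas matched_product_assoc_snd =
  matched_product_system.matched_product_assoc_fst[OF swap]

lemmas beta_inv_one [simp] = matched_product_system.alpha_inv_one[OF swap]
lemmas beta_fixes_one [simp] = matched_product_system.alpha_fixes_one[OF swap]

lemma group_matched_product: "group (matched_product H K \<alpha> \<beta>)" (is "group ?M")
proof (rule groupI)
  fix x y z assume "x \<in> carrier ?M" "y \<in> carrier ?M" "z \<in> carrier ?M"
  then show "x \<otimes>\<^bsub>?M\<^esub> y \<otimes>\<^bsub>?M\<^esub> z = x \<otimes>\<^bsub>?M\<^esub> (y \<otimes>\<^bsub>?M\<^esub> z)"
    by (auto simp: matched_product_def matched_product_assoc_fst matched_product_assoc_snd)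
next
  fix x assume "x \<in> carrier ?M"
  then obtain b v where x: "x = (b, v)" "b \<in> carrier H" "v \<in> carrier K"
    by (auto simp: matched_product_def)
  \<comment> \<open>With \<open>u'\<close> the preimage of \<open>u\<close> under
    \<open>\<beta> a\<close>, the product \<open>(a, u) (b, v)\<close> has coordinates
    \<open>a (\<alpha> u' b)\<close> and \<open>\<beta> a (u' v)\<close>. Both become the identity
    once \<open>u'\<close> is the inverse of \<open>v\<close> and \<open>a\<close> the inverse of
    \<open>\<alpha> u' b\<close>; then \<open>u\<close> is recovered as
    \<open>\<beta> a u'\<close>.\<close>
  define a where "a = inv\<^bsub>H\<^esub> (\<alpha> (inv\<^bsub>K\<^esub> v) b)"
  define u where "u = \<beta> a (inv\<^bsub>K\<^esub> v)"
  have au: "a \<in> carrier H" "u \<in> carrier K" using x by (auto simp: a_def u_def)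
  have u': "inv_into (carrier K) (\<beta> a) u = inv\<^bsub>K\<^esub> v"
    using x au by (simp add: u_def)
  have "u \<otimes>\<^bsub>K\<^esub> \<beta> (inv_into (carrier H) (\<alpha> u) a) v = \<one>\<^bsub>K\<^esub>"
    using beta_matched[of a u v] x au u' by (simp add: K.l_inv)
  moreover have "a \<otimes>\<^bsub>H\<^esub> \<alpha> (inv\<^bsub>K\<^esub> v) b = \<one>\<^bsub>H\<^esub>"
    using x by (simp add: a_def H.l_inv)
  ultimately show "\<exists>y\<in>carrier ?M. y \<otimes>\<^bsub>?M\<^esub> x = \<one>\<^bsub>?M\<^esub>"
    using x au u' by (intro bexI[of _ "(a, u)"]) (auto simp: matched_product_def)
qed (auto simp: matched_product_def)

end

section \<open>Cancellation in a single affine structure\<close>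

context cancellative_affine_structure
begin

lemma sigma_bij: "a \<in> carrier G \<Longrightarrow> bij_betw (\<sigma> a) (carrier G) (carrier G)"
  using cancellative by (auto simp: Bij_def)

lemma sigma_ext: "a \<in> carrier G \<Longrightarrow> \<sigma> a \<in> extensional (carrier G)"
  using cancellative by (auto simp: Bij_def)

lemma sigma_closed [simp]:
  "\<lbrakk>a \<in> carrier G; b \<in> carrier G\<rbrakk> \<Longrightarrow> \<sigma> a b \<in> carrier G"
  using maps by auto

lemma sigma_eq_iff:
  "\<lbrakk>a \<in> carrier G; b \<in> carrier G; c \<in> carrier G\<rbrakk> \<Longrightarrow> \<sigma> a b = \<sigma> a c \<longleftrightarrow> b = c"
  by (metis bij_betw_imp_inj_on inj_on_eq_iff sigma_bij)

lemma sigma_surj: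
  "\<lbrakk>a \<in> carrier G; b \<in> carrier G\<rbrakk> \<Longrightarrow> \<exists>c\<in>carrier G. \<sigma> a c = b"
  using sigma_bij[of a] unfolding bij_betw_def by (metis imageE)

lemma sigma_mult:
  "\<lbrakk>a \<in> carrier G; b \<in> carrier G; c \<in> carrier G\<rbrakk> \<Longrightarrow> \<sigma> (a \<otimes> b) c = \<sigma> b (\<sigma> a c)"
  by (simp add: anti_hom compose_def)

lemma sigma_mult_eq_compose_iff:
  assumes "a \<in> carrier G" "b \<in> carrier G" "c \<in> carrier G"
  shows "\<sigma> (a \<otimes> c) = compose (carrier G) (\<sigma> b) (\<sigma> a) \<longleftrightarrow> \<sigma> c = \<sigma> b"
proof
  assume eq: "\<sigma> (a \<otimes> c) = compose (carrier G) (\<sigma> b) (\<sigma> a)"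
  show "\<sigma> c = \<sigma> b"
  proof (rule extensionalityI)
    fix x assume "x \<in> carrier G"
    then obtain y where y: "y \<in> carrier G" "\<sigma> a y = x" using sigma_surj assms by blast
    have "\<sigma> (a \<otimes> c) y = \<sigma> b (\<sigma> a y)" using eq y by (simp add: compose_def)
    then show "\<sigma> c x = \<sigma> b x" using y assms by (simp add: sigma_mult)
  qed (use assms sigma_ext in auto)
qed (simp add: assms anti_hom)

text \<open>One factor of the affine identity, with \<open>f\<close> and \<open>g\<close> arbitrary
  self-maps of the carrier. The same statement then serves the \<alpha>-twists in the first
  coordinate and the \<beta>-twists in the second.\<close>

lemma affine_twist_iff:
  assumes a: "a \<in> carrier G" and b: "b \<in> carrier G"
    and f: "\<And>x. x \<in> carrier G \<Longrightarrow> f x \<in> carrier G"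
    and g: "\<And>x. x \<in> carrier G \<Longrightarrow> g x \<in> carrier G"
  defines "r \<equiv> affine_rho G \<sigma> b (inv a)"
  shows "(\<forall>c\<in>carrier G. \<sigma> a (b \<otimes> f (\<sigma> b c)) = \<sigma> a b \<otimes> g (\<sigma> (\<sigma> a b) (\<sigma> a c)))
    \<longleftrightarrow> compose (carrier G) f (\<sigma> r) = compose (carrier G) (\<sigma> r) g"
proof -
  have r: "r \<in> carrier G" using a b by (simp add: r_def affine_rho_def)
  \<comment> \<open>Applying the anti-homomorphism \<sigma> to this factorization of
    \<open>b\<close> shows that \<open>\<sigma> r\<close> undoes the passage from
    \<open>\<sigma> b c\<close> to \<open>\<sigma> (\<sigma> a b) (\<sigma> a c)\<close>.\<close>
  have prod: "a \<otimes> \<sigma> a b \<otimes> r = b"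
  proof -
    have "a \<otimes> \<sigma> a b \<otimes> r = a \<otimes> (\<sigma> a b \<otimes> (inv (\<sigma> a b) \<otimes> (inv a \<otimes> b)))"
      using a b by (simp add: r_def affine_rho_def m_assoc)
    also have "\<dots> = a \<otimes> (inv a \<otimes> b)"
      using a b by (simp add: m_assoc[symmetric] r_inv)
    also have "\<dots> = b" using a b by (simp add: m_assoc[symmetric] r_inv)
    finally show ?thesis .
  qed
  have inverse: "\<sigma> r (\<sigma> (\<sigma> a b) (\<sigma> a c)) = \<sigma> b c" if "c \<in> carrier G" for c
    using sigma_mult[of "a \<otimes> \<sigma> a b" r c] sigma_mult[of a "\<sigma> a b" c] prod a b r that by simp
  have pointwise: "\<sigma> a (b \<otimes> f (\<sigma> b c)) = \<sigma> a b \<otimes> g (\<sigma> (\<sigma> a b) (\<sigma> a c))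
    \<longleftrightarrow> f (\<sigma> r y) = \<sigma> r (g y)"
    if c: "c \<in> carrier G" and y: "y = \<sigma> (\<sigma> a b) (\<sigma> a c)" for c y
  proof -
    \<comment> \<open>Absorbing the twist into a new argument \<open>c'\<close> makes the untwisted
      affine identity applicable.\<close>
    obtain c' where c': "c' \<in> carrier G" "\<sigma> b c' = f (\<sigma> b c)"
      using sigma_surj[of b "f (\<sigma> b c)"] f a b c by auto
    have "\<sigma> a (b \<otimes> f (\<sigma> b c)) = \<sigma> a b \<otimes> \<sigma> (\<sigma> a b) (\<sigma> a c')"
      using affine[of a b c'] a b c' by simp
    then have "\<sigma> a (b \<otimes> f (\<sigma> b c)) = \<sigma> a b \<otimes> g y \<longleftrightarrow> \<sigma> (\<sigma> a b) (\<sigma> a c') = g y"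
      using a b c c' g y by simp
    also have "\<dots> \<longleftrightarrow> \<sigma> r (\<sigma> (\<sigma> a b) (\<sigma> a c')) = \<sigma> r (g y)"
      using sigma_eq_iff a b c c' g r y by simp
    also have "\<dots> \<longleftrightarrow> f (\<sigma> r y) = \<sigma> r (g y)"
      using inverse c c' y by simp
    finally show ?thesis using y by simp
  qed
  \<comment> \<open>Every point of the carrier arises as such a \<open>y\<close>, so quantifying
    over \<open>c\<close> gives an equality of maps on the whole carrier.\<close>
  have surj: "\<exists>c\<in>carrier G. y = \<sigma> (\<sigma> a b) (\<sigma> a c)" if "y \<in> carrier G" for y
    by (metis a b sigma_closed sigma_surj that)
  have "(\<forall>c\<in>carrier G. \<sigma> a (b \<otimes> f (\<sigma> b c)) = \<sigma> a b \<otimes> g (\<sigma> (\<sigma> a b) (\<sigma> a c)))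
    \<longleftrightarrow> (\<forall>y\<in>carrier G. f (\<sigma> r y) = \<sigma> r (g y))"
    using pointwise surj a b by (metis sigma_closed)
  also have "\<dots> \<longleftrightarrow> compose (carrier G) f (\<sigma> r) = compose (carrier G) (\<sigma> r) g"
    by (auto simp: compose_def fun_eq_iff restrict_def)
  finally show ?thesis .
qed

end

section \<open>Componentwise maps on a product set\<close>

lemma restrict_prod_eq_iff:
  assumes "S \<noteq> {}" "T \<noteq> {}" "f \<in> extensional S" "f' \<in> extensional S"
    "g \<in> extensional T" "g' \<in> extensional T"
  shows "(\<lambda>(x, y)\<in>S \<times> T. (f x, g y)) = (\<lambda>(x, y)\<in>S \<times> T. (f' x, g' y)) \<longleftrightarrow> f = f' \<and> g = g'"
    (is "?l = ?r \<longleftrightarrow> _")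
proof
  assume eq: "?l = ?r"
  \<comment> \<open>Each component is tested on a pair, so a point of the other set must be
    available: this is where nonemptiness enters.\<close>
  have *: "f x = f' x \<and> g y = g' y" if "x \<in> S" "y \<in> T" for x y
    using that fun_cong[OF eq, of "(x, y)"] by simp
  show "f = f' \<and> g = g'"
    using assms * by (auto intro!: extensionalityI[of f S] extensionalityI[of g T])
qed simp

lemma compose_restrict_prod:
  assumes "f \<in> S \<rightarrow> S" "g \<in> T \<rightarrow> T"
  shows "compose (S \<times> T) (\<lambda>(x, y)\<in>S \<times> T. (f' x, g' y)) (\<lambda>(x, y)\<in>S \<times> T. (f x, g y))
    = (\<lambda>(x, y)\<in>S \<times> T. (compose S f' f x, compose T g' g y))"
  using assms by (auto simp: compose_def fun_eq_iff restrict_def)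

section \<open>The criterion for the matched product\<close>

theorem corollary19:
  fixes H :: "('a, 'm) monoid_scheme" and K :: "('b, 'n) monoid_scheme"
    and \<sigma>S :: "'a \<Rightarrow> 'a \<Rightarrow> 'a" and \<sigma>T :: "'b \<Rightarrow> 'b \<Rightarrow> 'b"
    and \<alpha> :: "'b \<Rightarrow> 'a \<Rightarrow> 'a" and \<beta> :: "'a \<Rightarrow> 'b \<Rightarrow> 'b"
  assumes "cancellative_affine_structure H \<sigma>S"
    and "cancellative_affine_structure K \<sigma>T"
    and "matched_product_system H K \<alpha> \<beta>"
  shows "cancellative_affine_structure (matched_product H K \<alpha> \<beta>)
           (product_affine (carrier H) (carrier K) \<sigma>S \<sigma>T)
    \<longleftrightarrow>
      (\<forall>a\<in>carrier H. \<forall>u\<in>carrier K. \<sigma>S (\<alpha> u a) = \<sigma>S a \<and> \<sigma>T (\<beta> a u) = \<sigma>T u) \<and>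
      (\<forall>a\<in>carrier H. \<forall>b\<in>carrier H. \<forall>u\<in>carrier K. \<forall>v\<in>carrier K.
        (let v' = inv_into (carrier K) (\<beta> b) v;
             b' = inv_into (carrier H) (\<alpha> v) b;
             V = inv_into (carrier K) (\<beta> (\<sigma>S a b)) (\<sigma>T u v);
             B = inv_into (carrier H) (\<alpha> (\<sigma>T u v)) (\<sigma>S a b);
             r = affine_rho H \<sigma>S b (inv\<^bsub>H\<^esub> a);
             s = affine_rho K \<sigma>T v (inv\<^bsub>K\<^esub> u)
         in compose (carrier H) (\<alpha> v') (\<sigma>S r) = compose (carrier H) (\<sigma>S r) (\<alpha> V) \<and>
            compose (carrier K) (\<beta> b') (\<sigma>T s) = compose (carrier K) (\<sigma>T s) (\<beta> B)))"
proof -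
  interpret S: cancellative_affine_structure H \<sigma>S by fact
  interpret T: cancellative_affine_structure K \<sigma>T by fact
  interpret matched_product_system H K \<alpha> \<beta> by fact
  let ?M = "matched_product H K \<alpha> \<beta>"
  let ?P = "product_affine (carrier H) (carrier K) \<sigma>S \<sigma>T"
  let ?II = "\<forall>a\<in>carrier H. \<forall>u\<in>carrier K. \<sigma>S (\<alpha> u a) = \<sigma>S a \<and> \<sigma>T (\<beta> a u) = \<sigma>T u"
  have carrier: "carrier ?M = carrier H \<times> carrier K"
    by (simp add: matched_product_def)
  have mult: "(a, u) \<otimes>\<^bsub>?M\<^esub> (b, v) =
      (a \<otimes>\<^bsub>H\<^esub> \<alpha> (inv_into (carrier K) (\<beta> a) u) b,
       u \<otimes>\<^bsub>K\<^esub> \<beta> (inv_into (carrier H) (\<alpha> u) a) v)" for a u b v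
    by (simp add: matched_product_def)
  have P: "?P (a, u) = (\<lambda>(b, v)\<in>carrier H \<times> carrier K. (\<sigma>S a b, \<sigma>T u v))" for a u
    by (simp add: product_affine_def)
  have P_bij: "?P x \<in> Bij (carrier ?M)" if "x \<in> carrier ?M" for x
    using that S.sigma_bij T.sigma_bij
    by (auto simp: carrier P Bij_def intro!: bij_betw_map_prod[unfolded map_prod_def])
  have P_maps: "?P \<in> carrier ?M \<rightarrow> (carrier ?M \<rightarrow>\<^sub>E carrier ?M)"
  proof
    fix x assume "x \<in> carrier ?M"
    from P_bij[OF this] show "?P x \<in> carrier ?M \<rightarrow>\<^sub>E carrier ?M"
      by (auto simp: Bij_def PiE_def dest: bij_betw_imp_funcset)
  qed
  have anti: "?P ((a, u) \<otimes>\<^bsub>?M\<^esub> (b, v)) = compose (carrier ?M) (?P (b, v)) (?P (a, u)) \<longleftrightarrow>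
      \<sigma>S (\<alpha> (inv_into (carrier K) (\<beta> a) u) b) = \<sigma>S b \<and>
      \<sigma>T (\<beta> (inv_into (carrier H) (\<alpha> u) a) v) = \<sigma>T v"
    if "a \<in> carrier H" "b \<in> carrier H" "u \<in> carrier K" "v \<in> carrier K" for a b u v
  proof -
    have "carrier H \<noteq> {}" "carrier K \<noteq> {}" by auto
    moreover have "\<sigma>S a \<in> carrier H \<rightarrow> carrier H" "\<sigma>T u \<in> carrier K \<rightarrow> carrier K"
      using that by auto
    ultimately show ?thesis
      using that unfolding mult P carrier
      by (simp add: compose_restrict_prod restrict_prod_eq_iff S.sigma_ext T.sigma_ext
          S.sigma_mult_eq_compose_iff T.sigma_mult_eq_compose_iff)
  qed
  have anti_iff: "(\<forall>x\<in>carrier ?M. \<forall>y\<in>carrier ?M.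
      ?P (x \<otimes>\<^bsub>?M\<^esub> y) = compose (carrier ?M) (?P y) (?P x)) \<longleftrightarrow> ?II" (is "?A \<longleftrightarrow> _")
  proof
    assume A: ?A
    show ?II
    proof (intro ballI conjI)
      \<comment> \<open>The twisted indices become \<open>u\<close> and \<open>a\<close> themselves
        when the index of the inverse permutation is an identity. Hence the pairs
        \<open>(1, u), (a, 1)\<close> and \<open>(a, 1), (1, u)\<close> give the two halves of
        (II).\<close>
      fix a u assume au: "a \<in> carrier H" "u \<in> carrier K"
      show "\<sigma>S (\<alpha> u a) = \<sigma>S a"
        using A anti[of "\<one>\<^bsub>H\<^esub>" a u "\<one>\<^bsub>K\<^esub>"] au by (simp add: carrier)
      show "\<sigma>T (\<beta> a u) = \<sigma>T u"
        using A anti[of a "\<one>\<^bsub>H\<^esub>" "\<one>\<^bsub>K\<^esub>" u] au by (simp add: carrier)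
    qed
  next
    assume ?II
    then show ?A using anti by (auto simp: carrier)
  qed
  define III where "III a b u v \<longleftrightarrow>
      compose (carrier H) (\<alpha> (inv_into (carrier K) (\<beta> b) v)) (\<sigma>S (affine_rho H \<sigma>S b (inv\<^bsub>H\<^esub> a)))
      = compose (carrier H) (\<sigma>S (affine_rho H \<sigma>S b (inv\<^bsub>H\<^esub> a)))
          (\<alpha> (inv_into (carrier K) (\<beta> (\<sigma>S a b)) (\<sigma>T u v))) \<and>
      compose (carrier K) (\<beta> (inv_into (carrier H) (\<alpha> v) b)) (\<sigma>T (affine_rho K \<sigma>T v (inv\<^bsub>K\<^esub> u)))
      = compose (carrier K) (\<sigma>T (affine_rho K \<sigma>T v (inv\<^bsub>K\<^esub> u)))
          (\<beta> (inv_into (carrier H) (\<alpha> (\<sigma>T u v)) (\<sigma>S a b)))" for a b u v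
  have affine: "(\<forall>z\<in>carrier ?M. ?P (a, u) ((b, v) \<otimes>\<^bsub>?M\<^esub> ?P (b, v) z)
      = ?P (a, u) (b, v) \<otimes>\<^bsub>?M\<^esub> ?P (?P (a, u) (b, v)) (?P (a, u) z)) \<longleftrightarrow> III a b u v"
    if m: "a \<in> carrier H" "b \<in> carrier H" "u \<in> carrier K" "v \<in> carrier K" for a b u v
  proof -
    let ?v' = "inv_into (carrier K) (\<beta> b) v" and ?b' = "inv_into (carrier H) (\<alpha> v) b"
    let ?V = "inv_into (carrier K) (\<beta> (\<sigma>S a b)) (\<sigma>T u v)"
    let ?B = "inv_into (carrier H) (\<alpha> (\<sigma>T u v)) (\<sigma>S a b)"
    have "(\<forall>z\<in>carrier ?M. ?P (a, u) ((b, v) \<otimes>\<^bsub>?M\<^esub> ?P (b, v) z)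
        = ?P (a, u) (b, v) \<otimes>\<^bsub>?M\<^esub> ?P (?P (a, u) (b, v)) (?P (a, u) z)) \<longleftrightarrow>
      (\<forall>c\<in>carrier H. \<forall>w\<in>carrier K.
        \<sigma>S a (b \<otimes>\<^bsub>H\<^esub> \<alpha> ?v' (\<sigma>S b c)) = \<sigma>S a b \<otimes>\<^bsub>H\<^esub> \<alpha> ?V (\<sigma>S (\<sigma>S a b) (\<sigma>S a c)) \<and>
        \<sigma>T u (v \<otimes>\<^bsub>K\<^esub> \<beta> ?b' (\<sigma>T v w)) = \<sigma>T u v \<otimes>\<^bsub>K\<^esub> \<beta> ?B (\<sigma>T (\<sigma>T u v) (\<sigma>T u w)))"
      using m by (simp add: carrier P mult)
    also have "\<dots> \<longleftrightarrow>
      (\<forall>c\<in>carrier H.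
        \<sigma>S a (b \<otimes>\<^bsub>H\<^esub> \<alpha> ?v' (\<sigma>S b c)) = \<sigma>S a b \<otimes>\<^bsub>H\<^esub> \<alpha> ?V (\<sigma>S (\<sigma>S a b) (\<sigma>S a c))) \<and>
      (\<forall>w\<in>carrier K.
        \<sigma>T u (v \<otimes>\<^bsub>K\<^esub> \<beta> ?b' (\<sigma>T v w)) = \<sigma>T u v \<otimes>\<^bsub>K\<^esub> \<beta> ?B (\<sigma>T (\<sigma>T u v) (\<sigma>T u w)))"
      \<comment> \<open>Each conjunct involves only one of \<open>c\<close> and \<open>w\<close>;
        the identities witness that the other quantifier ranges over a nonempty set, so the
        conjunction splits.\<close>
      using S.one_closed T.one_closed by blast
    also have "\<dots> \<longleftrightarrow> III a b u v"
      unfolding III_def using m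
      by (simp add: S.affine_twist_iff T.affine_twist_iff)
    finally show ?thesis .
  qed
  have affine_iff: "(\<forall>x\<in>carrier ?M. \<forall>y\<in>carrier ?M. \<forall>z\<in>carrier ?M.
      ?P x (y \<otimes>\<^bsub>?M\<^esub> ?P y z) = ?P x y \<otimes>\<^bsub>?M\<^esub> ?P (?P x y) (?P x z)) \<longleftrightarrow>
    (\<forall>a\<in>carrier H. \<forall>b\<in>carrier H. \<forall>u\<in>carrier K. \<forall>v\<in>carrier K. III a b u v)"
    (is "(\<forall>x\<in>_. \<forall>y\<in>_. ?Q x y) \<longleftrightarrow> _")
  proof -
    have "(\<forall>x\<in>carrier ?M. \<forall>y\<in>carrier ?M. ?Q x y) \<longleftrightarrow>
      (\<forall>a\<in>carrier H. \<forall>b\<in>carrier H. \<forall>u\<in>carrier K. \<forall>v\<in>carrier K. ?Q (a, u) (b, v))"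
      unfolding carrier by blast
    then show ?thesis using affine by simp
  qed
  \<comment> \<open>The group laws, the typing of \<open>?P\<close> and its bijectivity hold without
    (II) and (III), so only the anti-homomorphism and affine identities remain to be
    characterized.\<close>
  have "cancellative_affine_structure ?M ?P \<longleftrightarrow>
      (\<forall>x\<in>carrier ?M. \<forall>y\<in>carrier ?M. ?P (x \<otimes>\<^bsub>?M\<^esub> y) = compose (carrier ?M) (?P y) (?P x)) \<and>
      (\<forall>x\<in>carrier ?M. \<forall>y\<in>carrier ?M. \<forall>z\<in>carrier ?M.
        ?P x (y \<otimes>\<^bsub>?M\<^esub> ?P y z) = ?P x y \<otimes>\<^bsub>?M\<^esub> ?P (?P x y) (?P x z))"
    using group_matched_product P_maps P_bij
    unfolding cancellative_affine_structure_def cancellative_affine_structure_axioms_def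
      affine_structure_def affine_structure_axioms_def
    by blast
  then show ?thesis
    unfolding anti_iff affine_iff III_def Let_def .
qed

end
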